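(* Let $S$ be a regular $\Gamma$-semigroup. Then: $S$ is left duo if and only if $S$ is fuzzy left duo; $S$ is right duo if and only if $S$ is fuzzy right duo; and $S$ is duo if and only if $S$ is fuzzy duo.
   Context: Let $S$ and $\Gamma$ be non-empty sets. $S$ is a $\Gamma$-semigroup if there is a map $S\times\Gamma\times S\to S$, written $(a,\alpha,b)\mapsto a\alpha b$, with $(x\beta y)\gamma z=x\beta(y\gamma z)$ for all $x,y,z\in S$, $\beta,\gamma\in\Gamma$. $S$ is regular if for each $a\in S$ there exist $x\in S$ and $\alpha,\beta\in\Gamma$ with $a=a\alpha x\beta a$. For $A,B\subseteq S$, $A\Gamma B=\{a\gamma b: a\in A,b\in B,\gamma\in\Gamma\}$. A left (right) ideal of $S$ is a non-empty $I\subseteq S$ with $S\Gamma I\subseteq I$ ($I\Gamma S\subseteq I$); a (two-sided) ideal is both a left and a right ideal. $S$ is left (right) duo if every left (right) ideal of $S$ is a two-sided ideal; $S$ is duo if it is both left and right duo. A fuzzy subset of $S$ is a function $\mu:S\to[0,1]$; it is non-empty if it is not identically $0$. A non-empty fuzzy subset $\mu$ is a fuzzy left ideal if $\mu(x\gamma y)\ge\mu(y)$ for all $x,y\in S,\gamma\in\Gamma$; a fuzzy right ideal if $\mu(x\gamma y)\ge\mu(x)$ for all $x,y\in S,\gamma\in\Gamma$; a fuzzy ideal if it is both. $S$ is fuzzy left (right) duo if every fuzzy left (right) ideal of $S$ is a fuzzy ideal; $S$ is fuzzy duo if it is both fuzzy left and fuzzy right duo. *)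

theory Defs
  imports Complex_Main "HOL-Library.FuncSet"
begin

(* The carriers S and \<Gamma> are arbitrary non-empty sets of their ambient types; the
   ternary map is a total HOL function of which only the values on S, \<Gamma>, S matter. *)
locale gamma_semigroup =
  fixes S :: "'a set" and \<Gamma> :: "'g set" and mul :: "'a \<Rightarrow> 'g \<Rightarrow> 'a \<Rightarrow> 'a"
  assumes carrier_nonempty: "S \<noteq> {}"
    and gamma_nonempty: "\<Gamma> \<noteq> {}"
    and mul_closed: "\<lbrakk>a \<in> S; \<alpha> \<in> \<Gamma>; b \<in> S\<rbrakk> \<Longrightarrow> mul a \<alpha> b \<in> S"
    and mul_assoc: "\<lbrakk>x \<in> S; \<beta> \<in> \<Gamma>; y \<in> S; \<gamma> \<in> \<Gamma>; z \<in> S\<rbrakk>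
      \<Longrightarrow> mul (mul x \<beta> y) \<gamma> z = mul x \<beta> (mul y \<gamma> z)"

(* The product of a, \<alpha>, x, \<beta>, a is bracketed to the left; by associativity the
   bracketing does not matter in a gamma semigroup. *)
definition gamma_regular :: "'a set \<Rightarrow> 'g set \<Rightarrow> ('a \<Rightarrow> 'g \<Rightarrow> 'a \<Rightarrow> 'a) \<Rightarrow> bool" where
  "gamma_regular S \<Gamma> mul \<longleftrightarrow>
     (\<forall>a\<in>S. \<exists>x\<in>S. \<exists>\<alpha>\<in>\<Gamma>. \<exists>\<beta>\<in>\<Gamma>. a = mul (mul a \<alpha> x) \<beta> a)"

definition gamma_set_prod ::
    "'g set \<Rightarrow> ('a \<Rightarrow> 'g \<Rightarrow> 'a \<Rightarrow> 'a) \<Rightarrow> 'a set \<Rightarrow> 'a set \<Rightarrow> 'a set" where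
  "gamma_set_prod \<Gamma> mul A B = {mul a \<gamma> b | a \<gamma> b. a \<in> A \<and> b \<in> B \<and> \<gamma> \<in> \<Gamma>}"

definition left_ideal :: "'a set \<Rightarrow> 'g set \<Rightarrow> ('a \<Rightarrow> 'g \<Rightarrow> 'a \<Rightarrow> 'a) \<Rightarrow> 'a set \<Rightarrow> bool" where
  "left_ideal S \<Gamma> mul I \<longleftrightarrow> I \<subseteq> S \<and> I \<noteq> {} \<and> gamma_set_prod \<Gamma> mul S I \<subseteq> I"

definition right_ideal :: "'a set \<Rightarrow> 'g set \<Rightarrow> ('a \<Rightarrow> 'g \<Rightarrow> 'a \<Rightarrow> 'a) \<Rightarrow> 'a set \<Rightarrow> bool" where
  "right_ideal S \<Gamma> mul I \<longleftrightarrow> I \<subseteq> S \<and> I \<noteq> {} \<and> gamma_set_prod \<Gamma> mul I S \<subseteq> I"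

definition two_sided_ideal :: "'a set \<Rightarrow> 'g set \<Rightarrow> ('a \<Rightarrow> 'g \<Rightarrow> 'a \<Rightarrow> 'a) \<Rightarrow> 'a set \<Rightarrow> bool" where
  "two_sided_ideal S \<Gamma> mul I \<longleftrightarrow> left_ideal S \<Gamma> mul I \<and> right_ideal S \<Gamma> mul I"

definition left_duo :: "'a set \<Rightarrow> 'g set \<Rightarrow> ('a \<Rightarrow> 'g \<Rightarrow> 'a \<Rightarrow> 'a) \<Rightarrow> bool" where
  "left_duo S \<Gamma> mul \<longleftrightarrow> (\<forall>I. left_ideal S \<Gamma> mul I \<longrightarrow> two_sided_ideal S \<Gamma> mul I)"

definition right_duo :: "'a set \<Rightarrow> 'g set \<Rightarrow> ('a \<Rightarrow> 'g \<Rightarrow> 'a \<Rightarrow> 'a) \<Rightarrow> bool" where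
  "right_duo S \<Gamma> mul \<longleftrightarrow> (\<forall>I. right_ideal S \<Gamma> mul I \<longrightarrow> two_sided_ideal S \<Gamma> mul I)"

definition duo :: "'a set \<Rightarrow> 'g set \<Rightarrow> ('a \<Rightarrow> 'g \<Rightarrow> 'a \<Rightarrow> 'a) \<Rightarrow> bool" where
  "duo S \<Gamma> mul \<longleftrightarrow> left_duo S \<Gamma> mul \<and> right_duo S \<Gamma> mul"

(* The values of \<mu> outside S are unconstrained; no notion below depends on them. *)
definition nonempty_fuzzy_subset :: "'a set \<Rightarrow> ('a \<Rightarrow> real) \<Rightarrow> bool" where
  "nonempty_fuzzy_subset S \<mu> \<longleftrightarrow> \<mu> \<in> S \<rightarrow> {0..1} \<and> \<not> (\<forall>x\<in>S. \<mu> x = 0)"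

definition fuzzy_left_ideal ::
    "'a set \<Rightarrow> 'g set \<Rightarrow> ('a \<Rightarrow> 'g \<Rightarrow> 'a \<Rightarrow> 'a) \<Rightarrow> ('a \<Rightarrow> real) \<Rightarrow> bool" where
  "fuzzy_left_ideal S \<Gamma> mul \<mu> \<longleftrightarrow> nonempty_fuzzy_subset S \<mu> \<and>
     (\<forall>x\<in>S. \<forall>y\<in>S. \<forall>\<gamma>\<in>\<Gamma>. \<mu> (mul x \<gamma> y) \<ge> \<mu> y)"

definition fuzzy_right_ideal ::
    "'a set \<Rightarrow> 'g set \<Rightarrow> ('a \<Rightarrow> 'g \<Rightarrow> 'a \<Rightarrow> 'a) \<Rightarrow> ('a \<Rightarrow> real) \<Rightarrow> bool" where
  "fuzzy_right_ideal S \<Gamma> mul \<mu> \<longleftrightarrow> nonempty_fuzzy_subset S \<mu> \<and>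
     (\<forall>x\<in>S. \<forall>y\<in>S. \<forall>\<gamma>\<in>\<Gamma>. \<mu> (mul x \<gamma> y) \<ge> \<mu> x)"

definition fuzzy_ideal ::
    "'a set \<Rightarrow> 'g set \<Rightarrow> ('a \<Rightarrow> 'g \<Rightarrow> 'a \<Rightarrow> 'a) \<Rightarrow> ('a \<Rightarrow> real) \<Rightarrow> bool" where
  "fuzzy_ideal S \<Gamma> mul \<mu> \<longleftrightarrow> fuzzy_left_ideal S \<Gamma> mul \<mu> \<and> fuzzy_right_ideal S \<Gamma> mul \<mu>"

definition fuzzy_left_duo :: "'a set \<Rightarrow> 'g set \<Rightarrow> ('a \<Rightarrow> 'g \<Rightarrow> 'a \<Rightarrow> 'a) \<Rightarrow> bool" where
  "fuzzy_left_duo S \<Gamma> mul \<longleftrightarrow>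
     (\<forall>\<mu>. fuzzy_left_ideal S \<Gamma> mul \<mu> \<longrightarrow> fuzzy_ideal S \<Gamma> mul \<mu>)"

definition fuzzy_right_duo :: "'a set \<Rightarrow> 'g set \<Rightarrow> ('a \<Rightarrow> 'g \<Rightarrow> 'a \<Rightarrow> 'a) \<Rightarrow> bool" where
  "fuzzy_right_duo S \<Gamma> mul \<longleftrightarrow>
     (\<forall>\<mu>. fuzzy_right_ideal S \<Gamma> mul \<mu> \<longrightarrow> fuzzy_ideal S \<Gamma> mul \<mu>)"

definition fuzzy_duo :: "'a set \<Rightarrow> 'g set \<Rightarrow> ('a \<Rightarrow> 'g \<Rightarrow> 'a \<Rightarrow> 'a) \<Rightarrow> bool" where
  "fuzzy_duo S \<Gamma> mul \<longleftrightarrow> fuzzy_left_duo S \<Gamma> mul \<and> fuzzy_right_duo S \<Gamma> mul"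

end

theory Submission
  imports Defs "HOL-Library.Indicator_Function"
begin

text \<open>
  A fuzzy subset is a fuzzy left (right) ideal exactly when its non-empty level sets are left
  (right) ideals, and a subset is a left (right) ideal exactly when its indicator function is a
  fuzzy one. To transfer the duo property to a fuzzy left ideal \<open>\<mu>\<close>, apply it to the level set of
  \<open>\<mu>\<close> at height \<open>\<mu> x\<close>, which contains \<open>x\<close> and hence every \<open>x \<gamma> y\<close>.
\<close>

lemma left_ideal_iff:
  "left_ideal S \<Gamma> mul I \<longleftrightarrow>
     I \<subseteq> S \<and> I \<noteq> {} \<and> (\<forall>x\<in>S. \<forall>y\<in>I. \<forall>\<gamma>\<in>\<Gamma>. mul x \<gamma> y \<in> I)"
  unfolding left_ideal_def gamma_set_prod_def by blast

lemma right_ideal_iff: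
  "right_ideal S \<Gamma> mul I \<longleftrightarrow>
     I \<subseteq> S \<and> I \<noteq> {} \<and> (\<forall>x\<in>I. \<forall>y\<in>S. \<forall>\<gamma>\<in>\<Gamma>. mul x \<gamma> y \<in> I)"
  unfolding right_ideal_def gamma_set_prod_def by blast

lemma nonempty_fuzzy_subset_indicator:
  assumes "I \<subseteq> S" "I \<noteq> {}"
  shows "nonempty_fuzzy_subset S (indicator I)"
  using assms unfolding nonempty_fuzzy_subset_def by (auto simp: indicator_def)

text \<open>The indicator takes only the values 0 and 1, so the inequality at
  \<open>mul x \<gamma> y\<close> is vacuous for \<open>y\<close> outside \<open>I\<close>, and for
  \<open>y\<close> in \<open>I\<close> it forces the product into \<open>I\<close>.\<close>

lemma fuzzy_left_ideal_indicator_iff: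
  assumes "I \<subseteq> S" "I \<noteq> {}"
  shows "fuzzy_left_ideal S \<Gamma> mul (indicator I) \<longleftrightarrow> left_ideal S \<Gamma> mul I"
  using assms nonempty_fuzzy_subset_indicator[OF assms]
  unfolding fuzzy_left_ideal_def left_ideal_iff
  by (auto simp: indicator_def split: if_splits)

lemma fuzzy_right_ideal_indicator_iff:
  assumes "I \<subseteq> S" "I \<noteq> {}"
  shows "fuzzy_right_ideal S \<Gamma> mul (indicator I) \<longleftrightarrow> right_ideal S \<Gamma> mul I"
  using assms nonempty_fuzzy_subset_indicator[OF assms]
  unfolding fuzzy_right_ideal_def right_ideal_iff
  by (auto simp: indicator_def split: if_splits)

context gamma_semigroup
begin

text \<open>Forwards, chain \<open>\<mu> x \<le> \<mu> y\<close> with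
  \<open>\<mu> y \<le> \<mu> (mul s \<gamma> y)\<close>. Backwards, use the level at the height of
  the right factor itself. Taking only attained heights keeps every level set non-empty.\<close>

lemma fuzzy_left_ideal_iff_level_sets:
  assumes "nonempty_fuzzy_subset S \<mu>"
  shows "fuzzy_left_ideal S \<Gamma> mul \<mu> \<longleftrightarrow> (\<forall>x\<in>S. left_ideal S \<Gamma> mul {z \<in> S. \<mu> x \<le> \<mu> z})"
  using assms mul_closed unfolding fuzzy_left_ideal_def left_ideal_iff
  by (auto intro: order_trans)

lemma fuzzy_right_ideal_iff_level_sets:
  assumes "nonempty_fuzzy_subset S \<mu>"
  shows "fuzzy_right_ideal S \<Gamma> mul \<mu> \<longleftrightarrow> (\<forall>x\<in>S. right_ideal S \<Gamma> mul {z \<in> S. \<mu> x \<le> \<mu> z})"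
  using assms mul_closed unfolding fuzzy_right_ideal_def right_ideal_iff
  by (auto intro: order_trans)

lemma left_duo_iff_fuzzy_left_duo: "left_duo S \<Gamma> mul \<longleftrightarrow> fuzzy_left_duo S \<Gamma> mul"
proof
  assume duo: "left_duo S \<Gamma> mul"
  show "fuzzy_left_duo S \<Gamma> mul"
    unfolding fuzzy_left_duo_def fuzzy_ideal_def
  proof (intro allI impI conjI)
    fix \<mu> assume \<mu>: "fuzzy_left_ideal S \<Gamma> mul \<mu>"
    \<comment> \<open>Both level-set criteria assume this: the zero function has \<open>S\<close> as
      its only level set, an ideal, yet is no fuzzy ideal.\<close>
    then have ne: "nonempty_fuzzy_subset S \<mu>"
      by (simp add: fuzzy_left_ideal_def)
    show "fuzzy_right_ideal S \<Gamma> mul \<mu>"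
      using \<mu> duo unfolding fuzzy_left_ideal_iff_level_sets[OF ne]
        fuzzy_right_ideal_iff_level_sets[OF ne] left_duo_def two_sided_ideal_def by blast
  qed
next
  assume fduo: "fuzzy_left_duo S \<Gamma> mul"
  show "left_duo S \<Gamma> mul"
    unfolding left_duo_def two_sided_ideal_def
  proof (intro allI impI conjI)
    fix I assume I: "left_ideal S \<Gamma> mul I"
    then have sub: "I \<subseteq> S" "I \<noteq> {}"
      by (auto simp: left_ideal_def)
    show "right_ideal S \<Gamma> mul I"
      \<comment> \<open>The fuzzy hypothesis is instantiated at \<open>indicator I\<close>.\<close>
      using I fduo fuzzy_left_ideal_indicator_iff[OF sub] fuzzy_right_ideal_indicator_iff[OF sub]
      unfolding fuzzy_left_duo_def fuzzy_ideal_def by blast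
  qed
qed

lemma right_duo_iff_fuzzy_right_duo: "right_duo S \<Gamma> mul \<longleftrightarrow> fuzzy_right_duo S \<Gamma> mul"
proof
  assume duo: "right_duo S \<Gamma> mul"
  show "fuzzy_right_duo S \<Gamma> mul"
    unfolding fuzzy_right_duo_def fuzzy_ideal_def
  proof (intro allI impI conjI)
    fix \<mu> assume \<mu>: "fuzzy_right_ideal S \<Gamma> mul \<mu>"
    then have ne: "nonempty_fuzzy_subset S \<mu>"
      by (simp add: fuzzy_right_ideal_def)
    show "fuzzy_left_ideal S \<Gamma> mul \<mu>"
      \<comment> \<open>Both criteria range over the same level sets, so \<open>duo\<close> turns
        right ideals into left ones set by set.\<close>
      using \<mu> duo unfolding fuzzy_left_ideal_iff_level_sets[OF ne]
        fuzzy_right_ideal_iff_level_sets[OF ne] right_duo_def two_sided_ideal_def by blast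
  qed
next
  assume fduo: "fuzzy_right_duo S \<Gamma> mul"
  show "right_duo S \<Gamma> mul"
    unfolding right_duo_def two_sided_ideal_def
  proof (intro allI impI conjI)
    fix I assume I: "right_ideal S \<Gamma> mul I"
    then have sub: "I \<subseteq> S" "I \<noteq> {}"
      by (auto simp: right_ideal_def)
    show "left_ideal S \<Gamma> mul I"
      using I fduo fuzzy_left_ideal_indicator_iff[OF sub] fuzzy_right_ideal_indicator_iff[OF sub]
      unfolding fuzzy_right_duo_def fuzzy_ideal_def by blast
  qed
qed

end

theorem theorem4p9:
  fixes S :: "'a set" and \<Gamma> :: "'g set" and mul :: "'a \<Rightarrow> 'g \<Rightarrow> 'a \<Rightarrow> 'a"
  assumes "gamma_semigroup S \<Gamma> mul"
    and "gamma_regular S \<Gamma> mul"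
  shows "(left_duo S \<Gamma> mul \<longleftrightarrow> fuzzy_left_duo S \<Gamma> mul) \<and>
         (right_duo S \<Gamma> mul \<longleftrightarrow> fuzzy_right_duo S \<Gamma> mul) \<and>
         (duo S \<Gamma> mul \<longleftrightarrow> fuzzy_duo S \<Gamma> mul)"
  \<comment> \<open>The third equivalence is the conjunction of the two one-sided ones.\<close>
  using gamma_semigroup.left_duo_iff_fuzzy_left_duo[OF assms(1)]
    gamma_semigroup.right_duo_iff_fuzzy_right_duo[OF assms(1)]
  by (simp add: duo_def fuzzy_duo_def)

end
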